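(* Let $(\mathcal{L},\mathcal{H},(\cdot,\cdot))$ be an extended affine Lie superalgebra with root system $R$. Then $R$ is an extended affine root supersystem in its $\mathbb{Z}$-span (with respect to the restriction to this $\mathbb{Z}$-span of the form $(\alpha,\beta)=(t_\alpha,t_\beta)$).
   Context: All vector spaces are over a field $\mathbb{F}$ of characteristic zero. A super-toral triple $(\mathcal{L},\mathcal{H},(\cdot,\cdot))$ consists of a nonzero Lie superalgebra $\mathcal{L}=\mathcal{L}_{\bar 0}\oplus\mathcal{L}_{\bar 1}$, a nontrivial (nonzero) subalgebra $\mathcal{H}$ of $\mathcal{L}_{\bar 0}$ and a nondegenerate invariant even supersymmetric bilinear form $(\cdot,\cdot)$ on $\mathcal{L}$ such that: $\mathcal{L}$ has a weight space decomposition $\mathcal{L}=\bigoplus_{\alpha\in\mathcal{H}^*}\mathcal{L}^\alpha$ with respect to $\mathcal{H}$ via the adjoint representation, where $\mathcal{L}^\alpha=\{x\in\mathcal{L}\mid [h,x]=\alpha(h)x\ \forall h\in\mathcal{H}\}$; and the restriction of the form to $\mathcal{H}$ is nondegenerate. Then $\mathcal{H}$ is abelian and, for $i\in\{0,1\}$, $\mathcal{L}_{\bar i}=\bigoplus_\alpha\mathcal{L}_{\bar i}^\alpha$ with $\mathcal{L}_{\bar i}^\alpha:=\mathcal{L}_{\bar i}\cap\mathcal{L}^\alpha$. Put $R:=\{\alpha\in\mathcal{H}^*\mid\mathcal{L}^\alpha\neq\{0\}\}$ (the root system) and $R_i:=\{\alpha\in\mathcal{H}^*\mid\mathcal{L}_{\bar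 i}^\alpha\neq\{0\}\}$ for $i=0,1$, so $R=R_0\cup R_1$. Let $\mathfrak{p}:\mathcal{H}\to\mathcal{H}^*$, $h\mapsto(h,\cdot)$, which is injective, and let $\mathcal{H}^{\mathfrak{p}}$ be its image. For $\alpha\in\mathcal{H}^{\mathfrak{p}}$ let $t_\alpha\in\mathcal{H}$ be the unique element with $\alpha=(t_\alpha,\cdot)$ on $\mathcal{H}$, and set $(\alpha,\beta):=(t_\alpha,t_\beta)$ for $\alpha,\beta\in\mathcal{H}^{\mathfrak{p}}$. A super-toral triple is an extended affine Lie superalgebra if (1) for $i\in\{0,1\}$ and $\alpha\in R_i\setminus\{0\}$ there are $x_\alpha\in\mathcal{L}_{\bar i}^\alpha$ and $x_{-\alpha}\in\mathcal{L}_{\bar i}^{-\alpha}$ with $0\neq[x_\alpha,x_{-\alpha}]\in\mathcal{H}$ (this implies $R\subseteq\mathcal{H}^{\mathfrak{p}}$, so that $(\alpha,\beta)$ is defined for roots), and (2) for $\alpha\in R$ with $(\alpha,\alpha)\neq0$ and $x\in\mathcal{L}^\alpha$, the map $\mathrm{ad}_x:\mathcal{L}\to\mathcal{L}$, $y\mapsto[x,y]$, is locally nilpotent. Extended affine root supersystems: let $A$ be a nontrivial additive abelian group, $(\cdot,\cdot):A\times A\to\mathbb{F}$ a symmetric form (a symmetric biadditive map), $A^0:=\{a\in A\mid(a,A)=\{0\}\}$, and $R\subseteq A$. Set $R^0:=R\cap A^0$, $R^\times:=R\setminus R^0$, $R_{re}^\times:=\{\alpha\in R\mid(\alpha,\alpha)\neq0\}$,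 $R_{re}:=R_{re}^\times\cup\{0\}$, $R_{ns}^\times:=\{\alpha\in R\setminus R^0\mid(\alpha,\alpha)=0\}$, $R_{ns}:=R_{ns}^\times\cup\{0\}$. Then $R$ is an extended affine root supersystem in $A$ if: (S1) $0\in R$ and $R$ generates $A$ as a group; (S2) $R=-R$; (S3) $2(\alpha,\beta)/(\alpha,\alpha)\in\mathbb{Z}$ for $\alpha\in R_{re}^\times$, $\beta\in R$; (S4) for $\alpha\in R_{re}^\times$ and $\beta\in R$ there are nonnegative integers $p,q$ with $2(\beta,\alpha)/(\alpha,\alpha)=p-q$ and $\{\beta+k\alpha\mid k\in\mathbb{Z}\}\cap R=\{\beta-p\alpha,\ldots,\beta+q\alpha\}$; (S5) for $\alpha\in R_{ns}$ and $\beta\in R$ with $(\alpha,\beta)\neq0$, $\{\beta-\alpha,\beta+\alpha\}\cap R\neq\emptyset$.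
   Formalization: The requirement that the ambient abelian group (the Z-span of R) be nontrivial is claimed only when R ≠ {0}, since it fails for R = {0} (e.g. L = H one-dimensional, even, abelian); the symmetric form and (S1)–(S5) are proved in all cases. *)

theory Defs
  imports
    Complex_Main
    "HOL-Library.Function_Algebras"
    "HOL-Library.Z2"
    "HOL-Computational_Algebra.Group_Closure"
begin

text \<open>
  A superspace is a vector space on a whole type 'v, with scalar multiplication
  scale over a field 'f of characteristic zero, together with a grading L indexed by
  the two-element field bit: the even part is L 0 and the odd part is L 1.
\<close>

definition direct_sum_decomposition :: "'i set \<Rightarrow> ('i \<Rightarrow> 'v::ab_group_add set) \<Rightarrow> bool" where
  "direct_sum_decomposition I V \<longleftrightarrow>
     (\<forall>x. \<exists>!f. (\<forall>i\<in>I. f i \<in> V i) \<and> (\<forall>i. i \<notin> I \<longrightarrow> f i = 0) \<and>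
               finite {i. f i \<noteq> 0} \<and> x = (\<Sum>i\<in>{i. f i \<noteq> 0}. f i))"

definition super_sign :: "bit \<Rightarrow> bit \<Rightarrow> 'f::ring_1" where
  "super_sign i j = (if i * j = 1 then - 1 else 1)"

locale lie_superalgebra =
  vector_space scale
  for scale :: "'f::field_char_0 \<Rightarrow> 'v::ab_group_add \<Rightarrow> 'v" +
  fixes L :: "bit \<Rightarrow> 'v set"
    and br :: "'v \<Rightarrow> 'v \<Rightarrow> 'v"
  assumes grading_subspace: "\<And>i. subspace (L i)"
    and grading: "direct_sum_decomposition UNIV L"
    and br_linear_right: "\<And>x. Vector_Spaces.linear scale scale (\<lambda>y. br x y)"
    and br_linear_left: "\<And>y. Vector_Spaces.linear scale scale (\<lambda>x. br x y)"
    and br_graded: "\<And>i j x y. x \<in> L i \<Longrightarrow> y \<in> L j \<Longrightarrow> br x y \<in> L (i + j)"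
    and super_antisymmetry:
      "\<And>i j x y. x \<in> L i \<Longrightarrow> y \<in> L j \<Longrightarrow> br x y = - scale (super_sign i j) (br y x)"
    and super_jacobi:
      "\<And>i j x y z. x \<in> L i \<Longrightarrow> y \<in> L j \<Longrightarrow>
         br x (br y z) = br (br x y) z + scale (super_sign i j) (br y (br x z))"

text \<open>
  The dual space of a subspace H. A functional on H is represented by the function on
  the ambient space that vanishes outside the set H; with this convention the pointwise
  operations on functions are the vector space operations of the dual, and its zero is 0.
\<close>

definition dual_space :: "('f::field \<Rightarrow> 'v::ab_group_add \<Rightarrow> 'v) \<Rightarrow> 'v set \<Rightarrow> ('v \<Rightarrow> 'f) set" where
  "dual_space scale H = {\<alpha>. (\<forall>x\<in>H. \<forall>y\<in>H. \<alpha> (x + y) = \<alpha> x + \<alpha> y) \<and>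
                            (\<forall>c. \<forall>x\<in>H. \<alpha> (scale c x) = c * \<alpha> x) \<and>
                            (\<forall>x. x \<notin> H \<longrightarrow> \<alpha> x = 0)}"

definition weight_space ::
  "('f::field \<Rightarrow> 'v::ab_group_add \<Rightarrow> 'v) \<Rightarrow> ('v \<Rightarrow> 'v \<Rightarrow> 'v) \<Rightarrow> 'v set \<Rightarrow> ('v \<Rightarrow> 'f) \<Rightarrow> 'v set" where
  "weight_space scale br H \<alpha> = {x. \<forall>h\<in>H. br h x = scale (\<alpha> h) x}"

definition root_system ::
  "('f::field \<Rightarrow> 'v::ab_group_add \<Rightarrow> 'v) \<Rightarrow> ('v \<Rightarrow> 'v \<Rightarrow> 'v) \<Rightarrow> 'v set \<Rightarrow> ('v \<Rightarrow> 'f) set" where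
  "root_system scale br H = {\<alpha> \<in> dual_space scale H. weight_space scale br H \<alpha> \<noteq> {0}}"

definition graded_root_system ::
  "('f::field \<Rightarrow> 'v::ab_group_add \<Rightarrow> 'v) \<Rightarrow> (bit \<Rightarrow> 'v set) \<Rightarrow> ('v \<Rightarrow> 'v \<Rightarrow> 'v) \<Rightarrow> 'v set \<Rightarrow>
   bit \<Rightarrow> ('v \<Rightarrow> 'f) set" where
  "graded_root_system scale L br H i =
     {\<alpha> \<in> dual_space scale H. L i \<inter> weight_space scale br H \<alpha> \<noteq> {0}}"

locale super_toral_triple =
  lie_superalgebra scale L br
  for scale :: "'f::field_char_0 \<Rightarrow> 'v::ab_group_add \<Rightarrow> 'v"
    and L :: "bit \<Rightarrow> 'v set"
    and br :: "'v \<Rightarrow> 'v \<Rightarrow> 'v" +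
  fixes H :: "'v set"
    and B :: "'v \<Rightarrow> 'v \<Rightarrow> 'f"
  assumes L_nonzero: "(UNIV :: 'v set) \<noteq> {0}"
    and H_subspace: "subspace H"
    and H_even: "H \<subseteq> L 0"
    and H_br_closed: "\<And>x y. x \<in> H \<Longrightarrow> y \<in> H \<Longrightarrow> br x y \<in> H"
    and H_nonzero: "H \<noteq> {0}"
    and B_linear_right: "\<And>x. Vector_Spaces.linear scale (*) (\<lambda>y. B x y)"
    and B_linear_left: "\<And>y. Vector_Spaces.linear scale (*) (\<lambda>x. B x y)"
    and B_even: "\<And>i j x y. i \<noteq> j \<Longrightarrow> x \<in> L i \<Longrightarrow> y \<in> L j \<Longrightarrow> B x y = 0"
    and B_supersymmetric:
      "\<And>i j x y. x \<in> L i \<Longrightarrow> y \<in> L j \<Longrightarrow> B x y = super_sign i j * B y x"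
    and B_invariant: "\<And>x y z. B (br x y) z = B x (br y z)"
    and B_nondegenerate: "\<And>x. (\<And>y. B x y = 0) \<Longrightarrow> x = 0"
    and weight_space_decomposition:
      "direct_sum_decomposition (dual_space scale H) (weight_space scale br H)"
    and B_nondegenerate_H: "\<And>x. x \<in> H \<Longrightarrow> (\<And>y. y \<in> H \<Longrightarrow> B x y = 0) \<Longrightarrow> x = 0"

text \<open>
  dual_vector and dual_form are meaningful only for functionals that the form
  represents by an element of H. In an extended affine Lie superalgebra all roots, hence
  all elements of the group generated by them, are of this kind.
\<close>

definition dual_vector :: "'v set \<Rightarrow> ('v \<Rightarrow> 'v \<Rightarrow> 'f) \<Rightarrow> ('v \<Rightarrow> 'f) \<Rightarrow> 'v" where
  "dual_vector H B \<alpha> = (THE t. t \<in> H \<and> (\<forall>h\<in>H. \<alpha> h = B t h))"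

definition dual_form :: "'v set \<Rightarrow> ('v \<Rightarrow> 'v \<Rightarrow> 'f) \<Rightarrow> ('v \<Rightarrow> 'f) \<Rightarrow> ('v \<Rightarrow> 'f) \<Rightarrow> 'f" where
  "dual_form H B \<alpha> \<beta> = B (dual_vector H B \<alpha>) (dual_vector H B \<beta>)"

locale extended_affine_lie_superalgebra =
  super_toral_triple scale L br H B
  for scale :: "'f::field_char_0 \<Rightarrow> 'v::ab_group_add \<Rightarrow> 'v"
    and L :: "bit \<Rightarrow> 'v set"
    and br :: "'v \<Rightarrow> 'v \<Rightarrow> 'v"
    and H :: "'v set"
    and B :: "'v \<Rightarrow> 'v \<Rightarrow> 'f" +
  assumes opposite_root_vectors:
      "\<And>i \<alpha>. \<alpha> \<in> graded_root_system scale L br H i - {0} \<Longrightarrow>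
         \<exists>x \<in> L i \<inter> weight_space scale br H \<alpha>. \<exists>y \<in> L i \<inter> weight_space scale br H (- \<alpha>).
           br x y \<noteq> 0 \<and> br x y \<in> H"
    and ad_locally_nilpotent:
      "\<And>\<alpha> x. \<alpha> \<in> root_system scale br H \<Longrightarrow> dual_form H B \<alpha> \<alpha> \<noteq> 0 \<Longrightarrow>
         x \<in> weight_space scale br H \<alpha> \<Longrightarrow> \<forall>y. \<exists>n. (br x ^^ n) y = 0"

definition int_multiple :: "int \<Rightarrow> 'a::ab_group_add \<Rightarrow> 'a" where
  "int_multiple k a = (if 0 \<le> k then (\<Sum>i<nat k. a) else - (\<Sum>i<nat (- k). a))"

definition form_radical :: "'a set \<Rightarrow> ('a \<Rightarrow> 'a \<Rightarrow> 'f::zero) \<Rightarrow> 'a set" where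
  "form_radical A form = {a \<in> A. \<forall>b\<in>A. form a b = 0}"

definition real_roots_nonzero :: "('a \<Rightarrow> 'a \<Rightarrow> 'f::zero) \<Rightarrow> 'a set \<Rightarrow> 'a set" where
  "real_roots_nonzero form R = {\<alpha> \<in> R. form \<alpha> \<alpha> \<noteq> 0}"

definition nonsingular_roots :: "'a::zero set \<Rightarrow> ('a \<Rightarrow> 'a \<Rightarrow> 'f::zero) \<Rightarrow> 'a set \<Rightarrow> 'a set" where
  "nonsingular_roots A form R =
     {\<alpha> \<in> R - (R \<inter> form_radical A form). form \<alpha> \<alpha> = 0} \<union> {0}"

text \<open>
  The abelian group A is a subgroup of a type of class ab_group_add; that it is closed
  under the group operations follows from S1. Only the values of form on A matter.
  The requirement that A be nontrivial is split off, because it fails for the Z-span of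
  the root system of an extended affine Lie superalgebra whose only root is zero, such as
  a one-dimensional even abelian algebra that equals its own H.
\<close>

locale extended_affine_root_supersystem_conditions =
  fixes A :: "'a::ab_group_add set"
    and form :: "'a \<Rightarrow> 'a \<Rightarrow> 'f::field_char_0"
    and R :: "'a set"
  assumes form_symmetric: "\<And>a b. a \<in> A \<Longrightarrow> b \<in> A \<Longrightarrow> form a b = form b a"
    and form_additive:
      "\<And>a b c. a \<in> A \<Longrightarrow> b \<in> A \<Longrightarrow> c \<in> A \<Longrightarrow> form (a + b) c = form a c + form b c"
      "\<And>a b c. a \<in> A \<Longrightarrow> b \<in> A \<Longrightarrow> c \<in> A \<Longrightarrow> form a (b + c) = form a b + form a c"
    and S1: "0 \<in> R" "group_closure R = A"
    and S2: "uminus ` R = R"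
    and S3: "\<And>\<alpha> \<beta>. \<alpha> \<in> real_roots_nonzero form R \<Longrightarrow> \<beta> \<in> R \<Longrightarrow>
               2 * form \<alpha> \<beta> / form \<alpha> \<alpha> \<in> \<int>"
    and S4: "\<And>\<alpha> \<beta>. \<alpha> \<in> real_roots_nonzero form R \<Longrightarrow> \<beta> \<in> R \<Longrightarrow>
               \<exists>p q :: nat. 2 * form \<beta> \<alpha> / form \<alpha> \<alpha> = of_nat p - of_nat q \<and>
                 {\<beta> + int_multiple k \<alpha> | k. True} \<inter> R =
                 {\<beta> + int_multiple k \<alpha> | k. - int p \<le> k \<and> k \<le> int q}"
    and S5: "\<And>\<alpha> \<beta>. \<alpha> \<in> nonsingular_roots A form R \<Longrightarrow> \<beta> \<in> R \<Longrightarrow> form \<alpha> \<beta> \<noteq> 0 \<Longrightarrow>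
               {\<beta> - \<alpha>, \<beta> + \<alpha>} \<inter> R \<noteq> {}"

locale extended_affine_root_supersystem =
  extended_affine_root_supersystem_conditions A form R
  for A :: "'a::ab_group_add set"
    and form :: "'a \<Rightarrow> 'a \<Rightarrow> 'f::field_char_0"
    and R :: "'a set" +
  assumes A_nontrivial: "A \<noteq> {0}"

end

theory Submission
  imports Defs
begin

text \<open>
  Let \<open>\<alpha>\<close> be a root with \<open>(\<alpha>, \<alpha>) \<noteq> 0\<close> and let \<open>x\<close>, \<open>y\<close> be homogeneous root vectors for
  \<open>\<alpha>\<close> and \<open>- \<alpha>\<close> whose bracket is a nonzero multiple of \<open>t\<^sub>\<alpha>\<close>. The super Jacobi identity gives
  \<open>x y\<^sup>j\<^sup>+\<^sup>1 w = c\<^sub>j y\<^sup>j w\<close> on a vector \<open>w\<close> of weight \<open>\<gamma>\<close> killed by \<open>x\<close>, with explicit scalars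
  \<open>c\<^sub>j\<close> in both parities. As \<open>y\<close> is locally nilpotent, some \<open>c\<^sub>j\<close> vanishes, and in both
  parities this forces \<open>2 (\<gamma>, \<alpha>) = j (\<alpha>, \<alpha>)\<close> for some \<open>j\<close> such that
  \<open>\<gamma>, \<gamma> - \<alpha>, \<dots>, \<gamma> - j \<alpha>\<close> are all roots. Integrality follows. Applying integrality to
  \<open>\<alpha>\<close> against the roots \<open>\<beta> + k \<alpha>\<close>, whose squared length grows quadratically in \<open>k\<close>
  while their pairing with \<open>\<alpha>\<close> grows linearly, shows that root strings are finite; the highest
  and the lowest member of the string then determine each other.
\<close>

lemma int_multiple_apply:
  fixes a :: "'v \<Rightarrow> 'f::field_char_0"
  shows "int_multiple k a v = of_int k * a v"
proof -
  have *: "(\<Sum>i<n. a) v = of_nat n * a v" for n :: nat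
    by (induction n) (simp_all add: algebra_simps del: sum_constant)
  show ?thesis
    by (cases "0 \<le> k") (simp_all add: int_multiple_def * del: sum_constant)
qed

lemma int_multiple_simps:
  fixes a :: "'v \<Rightarrow> 'f::field_char_0"
  shows "int_multiple 0 a = 0" "int_multiple (k + l) a = int_multiple k a + int_multiple l a"
    "int_multiple (k - l) a = int_multiple k a - int_multiple l a"
    "int_multiple 1 a = a" "int_multiple k (- a) = - int_multiple k a"
    "int_multiple (- k) a = - int_multiple k a"
  by (auto simp: fun_eq_iff int_multiple_apply algebra_simps)

lemma super_sign_even [simp]: "super_sign 0 i = 1" "super_sign i 0 = 1"
  by (simp_all add: super_sign_def)

lemma direct_sum_decomposition_exists:
  assumes "direct_sum_decomposition I V"
  obtains f where "\<And>i. i \<in> I \<Longrightarrow> f i \<in> V i" "\<And>i. i \<notin> I \<Longrightarrow> f i = 0"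
    "finite {i. f i \<noteq> 0}" "x = (\<Sum>i\<in>{i. f i \<noteq> 0}. f i)"
  using assms unfolding direct_sum_decomposition_def by metis

lemma direct_sum_decomposition_zero:
  assumes "direct_sum_decomposition I V" "\<And>i. i \<in> I \<Longrightarrow> 0 \<in> V i"
    and f: "\<And>i. i \<in> I \<Longrightarrow> f i \<in> V i" "\<And>i. i \<notin> I \<Longrightarrow> f i = 0"
    and F: "finite F" "{i. f i \<noteq> 0} \<subseteq> F" "sum f F = 0"
  shows "f i = 0"
proof -
  define P where "P g \<longleftrightarrow> (\<forall>i\<in>I. g i \<in> V i) \<and> (\<forall>i. i \<notin> I \<longrightarrow> g i = 0) \<and>
    finite {i. g i \<noteq> 0} \<and> 0 = (\<Sum>i\<in>{i. g i \<noteq> 0}. g i)" for g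
  have "\<exists>!g. P g"
    using assms(1) unfolding direct_sum_decomposition_def P_def by blast
  have "finite {i. f i \<noteq> 0}" by (rule finite_subset[OF F(2,1)])
  moreover have "sum f {i. f i \<noteq> 0} = sum f F"
    by (rule sum.mono_neutral_left[OF F(1,2)]) simp
  ultimately have "P f" using f F(3) by (simp add: P_def)
  moreover have "P (\<lambda>_. 0)" using assms(2) by (simp add: P_def)
  ultimately have "f = (\<lambda>_. 0)" using \<open>\<exists>!g. P g\<close> by blast
  then show ?thesis by simp
qed

lemma ladder_vanishing:
  fixes c :: "nat \<Rightarrow> 'f::field_char_0"
  assumes c0: "c 0 = l" and step: "\<And>j. c (Suc j) = l - of_nat (Suc j) * a + s * c j"
    and s: "s = 1 \<or> s = - 1" and a: "a \<noteq> 0" and z: "c j = 0"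
  shows "2 * l = of_nat j * a"
  using s
proof
  assume s: "s = 1"
  have "2 * c j = of_nat (Suc j) * (2 * l - of_nat j * a)" for j
  proof (induction j)
    case (Suc j)
    have "2 * c (Suc j) = 2 * (l - of_nat (Suc j) * a) + 2 * c j"
      by (simp only: step s) (simp add: algebra_simps)
    then show ?case unfolding Suc by (simp add: algebra_simps)
  qed (simp add: c0)
  from this[of j] z have "2 * l - of_nat j * a = 0"
    by (metis mult_eq_0_iff mult_zero_right of_nat_neq_0)
  then show ?thesis by simp
next
  assume s: "s = - 1"
  have c: "c (2 * i) = l - of_nat i * a \<and> c (Suc (2 * i)) = - of_nat (Suc i) * a" for i
  proof (induction i)
    case (Suc i)
    have odd: "c (Suc (2 * i)) = - of_nat (Suc i) * a" using Suc by simp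
    have "c (2 * Suc i) = l - of_nat (Suc (Suc (2 * i))) * a - c (Suc (2 * i))"
      using step[of "Suc (2 * i)"] by (simp add: s)
    then have even: "c (2 * Suc i) = l - of_nat (Suc i) * a"
      unfolding odd by (simp add: algebra_simps)
    have "c (Suc (2 * Suc i)) = l - of_nat (Suc (2 * Suc i)) * a - c (2 * Suc i)"
      using step[of "2 * Suc i"] by (simp add: s)
    then show ?case unfolding even by (simp add: algebra_simps)
  qed (use c0 step[of 0] s in simp)
  show ?thesis
  proof (cases "even j")
    case True
    then obtain i where "j = 2 * i" by (elim evenE)
    then show ?thesis using c[of i] z by simp
  next
    case False
    then obtain i where "j = Suc (2 * i)" by (metis oddE Suc_eq_plus1)
    then show ?thesis using c[of i] z a by (metis mult_eq_0_iff neg_equal_0_iff_equal of_nat_neq_0)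
  qed
qed

text \<open>
  With \<open>n = 2 (\<beta>, \<alpha>) / (\<alpha>, \<alpha>)\<close> and \<open>r = (\<beta>, \<beta>) / (\<alpha>, \<alpha>)\<close>, the hypothesis says that
  \<open>2 (\<alpha>, \<beta> + k \<alpha>)\<close> is an integer multiple of \<open>(\<beta> + k \<alpha>, \<beta> + k \<alpha>)\<close> whenever the latter
  is not zero. One such \<open>k\<close> makes \<open>r\<close> rational, whatever the field.
\<close>

lemma finite_integral_quadratic_quotients:
  fixes r :: "'f::field_char_0" and n :: int and S :: "int set"
  assumes S: "\<And>k. k \<in> S \<Longrightarrow> r + of_int (n * k + k * k) = 0 \<or>
      (\<exists>m::int. of_int (n + 2 * k) = of_int m * (r + of_int (n * k + k * k)))"
  shows "finite S"
proof (cases "\<exists>k\<in>S. n + 2 * k \<noteq> 0")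
  case False
  then have "S \<subseteq> {- (n div 2)}" by auto
  then show ?thesis by (rule finite_subset) simp
next
  case True
  then obtain k0 where k0: "k0 \<in> S" "n + 2 * k0 \<noteq> 0" by blast
  obtain D s :: int where D: "D \<noteq> 0" "of_int D * r = of_int s"
    using S[OF k0(1)]
  proof
    assume "r + of_int (n * k0 + k0 * k0) = 0"
    then have "of_int 1 * r = of_int (- (n * k0 + k0 * k0))"
      by (simp add: add_eq_0_iff2)
    then show ?thesis by (rule that[rotated]) simp
  next
    assume "\<exists>m::int. of_int (n + 2 * k0) = of_int m * (r + of_int (n * k0 + k0 * k0))"
    then obtain m :: int where m: "of_int (n + 2 * k0) = of_int m * (r + of_int (n * k0 + k0 * k0))"
      by blast
    have "m \<noteq> 0"
    proof
      assume "m = 0"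
      with m have "(of_int (n + 2 * k0) :: 'f) = 0" by simp
      then show False using k0(2) unfolding of_int_eq_0_iff by simp
    qed
    moreover have "of_int m * r = of_int (n + 2 * k0 - m * (n * k0 + k0 * k0))"
      using m by (simp add: algebra_simps)
    ultimately show ?thesis using that by blast
  qed
  define K where "K = 2 * \<bar>n\<bar> + \<bar>s\<bar> + 3"
  have "\<bar>k\<bar> \<le> K" if k: "k \<in> S" for k
  proof (rule ccontr)
    assume "\<not> \<bar>k\<bar> \<le> K"
    then have K: "\<bar>k\<bar> > K" by simp
    let ?q = "s + D * (n * k + k * k)"
    have q: "of_int D * (r + of_int (n * k + k * k)) = of_int ?q"
      using D(2) by (simp add: algebra_simps)
    have "\<exists>m::int. D * (n + 2 * k) = m * ?q \<or> ?q = 0"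
      using S[OF k]
    proof
      assume "r + of_int (n * k + k * k) = 0"
      then have "(of_int ?q :: 'f) = 0" using q by simp
      then show ?thesis unfolding of_int_eq_0_iff by blast
    next
      assume "\<exists>m::int. of_int (n + 2 * k) = of_int m * (r + of_int (n * k + k * k))"
      then obtain m :: int where "of_int (n + 2 * k) = of_int m * (r + of_int (n * k + k * k))"
        by blast
      then have "of_int (D * (n + 2 * k)) = of_int m * (of_int D * (r + of_int (n * k + k * k)))"
        by simp
      then have "(of_int (D * (n + 2 * k)) :: 'f) = of_int (m * ?q)"
        unfolding q by simp
      then show ?thesis unfolding of_int_eq_iff by blast
    qed
    moreover have "\<bar>?q\<bar> > \<bar>D * (n + 2 * k)\<bar>"
    proof -
      have 1: "\<bar>k\<bar> * (\<bar>k\<bar> - \<bar>n\<bar> - 2) \<ge> 1 * (\<bar>s\<bar> + \<bar>n\<bar> + 1)"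
        by (rule mult_mono) (use K in \<open>auto simp: K_def\<close>)
      have 2: "\<bar>n * k + k * k\<bar> \<ge> \<bar>k\<bar> * \<bar>k\<bar> - \<bar>n\<bar> * \<bar>k\<bar>"
        using abs_triangle_ineq2[of "k * k" "- (n * k)"] by (simp add: abs_mult add.commute)
      have 3: "\<bar>n + 2 * k\<bar> \<le> \<bar>n\<bar> + 2 * \<bar>k\<bar>" by linarith
      have 4: "\<bar>n * k + k * k\<bar> - \<bar>n + 2 * k\<bar> > \<bar>s\<bar>"
        using 1 2 3 by (simp add: algebra_simps)
      have "1 * (\<bar>n * k + k * k\<bar> - \<bar>n + 2 * k\<bar>) \<le> \<bar>D\<bar> * (\<bar>n * k + k * k\<bar> - \<bar>n + 2 * k\<bar>)"
        by (rule mult_right_mono) (use D(1) 4 in auto)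
      then have "\<bar>D * (n * k + k * k)\<bar> - \<bar>D * (n + 2 * k)\<bar> > \<bar>s\<bar>"
        using 4 by (simp add: abs_mult right_diff_distrib)
      then show ?thesis by linarith
    qed
    moreover have "n + 2 * k \<noteq> 0" using K unfolding K_def by linarith
    ultimately obtain m where m: "D * (n + 2 * k) = m * ?q" "m \<noteq> 0"
      using D(1) by (metis abs_ge_zero abs_zero leD mult_eq_0_iff)
    have "1 * \<bar>?q\<bar> \<le> \<bar>m\<bar> * \<bar>?q\<bar>" by (rule mult_right_mono) (use m in auto)
    then show False using m(1) \<open>\<bar>?q\<bar> > \<bar>D * (n + 2 * k)\<bar>\<close> by (simp add: abs_mult)
  qed
  then have "S \<subseteq> {- K..K}" by (auto simp: abs_le_iff) (smt (verit))+
  then show ?thesis by (rule finite_subset) simp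
qed

context lie_superalgebra
begin

lemma br_add_right: "br x (y + z) = br x y + br x z"
  using br_linear_right[of x] by (simp add: Vector_Spaces.linear_iff)

lemma br_scale_right: "br x (scale c y) = scale c (br x y)"
  using br_linear_right[of x] by (simp add: Vector_Spaces.linear_iff)

lemma br_scale_left: "br (scale c x) y = scale c (br x y)"
  using br_linear_left[of y] by (simp add: Vector_Spaces.linear_iff)

lemma br_zero_right [simp]: "br x 0 = 0"
  using br_add_right[of x 0 0] by simp

lemma br_sum_right: "br x (sum f F) = (\<Sum>i\<in>F. br x (f i))"
  by (induction F rule: infinite_finite_induct) (simp_all add: br_add_right)

lemma graded_components:
  obtains x0 x1 where "x0 \<in> L 0" "x1 \<in> L 1" "x = x0 + x1"
proof -
  obtain f where f: "\<And>i. i \<in> UNIV \<Longrightarrow> f i \<in> L i" "x = (\<Sum>i\<in>{i. f i \<noteq> 0}. f i)"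
    by (rule direct_sum_decomposition_exists[OF grading, of x]) blast
  have U: "(UNIV :: bit set) = {0, 1}"
    using bit.exhaust by auto
  have "x = (\<Sum>i\<in>UNIV. f i)"
    unfolding f(2) by (rule sum.mono_neutral_left) (auto simp: U)
  then have "x = f 0 + f 1" by (simp add: U)
  then show ?thesis using that f(1) by blast
qed

lemma graded_independent:
  assumes "x0 \<in> L 0" "x1 \<in> L 1" "x0 + x1 = 0"
  shows "x0 = 0 \<and> x1 = 0"
proof -
  define f where "f = (\<lambda>i :: bit. if i = 0 then x0 else x1)"
  have U: "(UNIV :: bit set) = {0, 1}"
    using bit.exhaust by auto
  have f: "f i \<in> L i" for i
    using assms by (cases i) (auto simp: f_def)
  have "f i = 0" for i
  proof (rule direct_sum_decomposition_zero[OF grading])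
    show "f j \<in> L j" "0 \<in> L j" for j
      using f subspace_0[OF grading_subspace] by auto
    show "sum f UNIV = 0"
      using assms(3) by (simp add: U f_def)
    show "finite (UNIV :: bit set)" by (simp add: U)
  qed simp_all
  from this[of 0] this[of 1] show ?thesis by (simp add: f_def)
qed

end

lemma dual_space_closed:
  fixes \<alpha> \<beta> :: "'v::ab_group_add \<Rightarrow> 'f::field"
  shows "\<alpha> \<in> dual_space scale H \<Longrightarrow> \<beta> \<in> dual_space scale H \<Longrightarrow> \<alpha> + \<beta> \<in> dual_space scale H"
    "\<alpha> \<in> dual_space scale H \<Longrightarrow> - \<alpha> \<in> dual_space scale H"
    "\<alpha> \<in> dual_space scale H \<Longrightarrow> \<beta> \<in> dual_space scale H \<Longrightarrow> \<alpha> - \<beta> \<in> dual_space scale H"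
  by (auto simp: dual_space_def algebra_simps)

context super_toral_triple
begin

abbreviation weight where "weight \<equiv> weight_space scale br H"
abbreviation roots where "roots \<equiv> root_system scale br H"
abbreviation dual where "dual \<equiv> dual_space scale H"

lemma weight_zero [simp]: "0 \<in> weight \<alpha>"
  by (simp add: weight_space_def)

lemma weight_scale: "x \<in> weight \<alpha> \<Longrightarrow> scale c x \<in> weight \<alpha>"
  by (simp add: weight_space_def br_scale_right mult.commute)

lemma rootI: "\<alpha> \<in> dual \<Longrightarrow> x \<in> weight \<alpha> \<Longrightarrow> x \<noteq> 0 \<Longrightarrow> \<alpha> \<in> roots"
  by (auto simp: root_system_def)

lemma rootE:
  assumes "\<alpha> \<in> roots"
  obtains x where "\<alpha> \<in> dual" "x \<in> weight \<alpha>" "x \<noteq> 0"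
proof -
  have "weight \<alpha> \<noteq> {0}" using assms by (simp add: root_system_def)
  then obtain x where "x \<in> weight \<alpha>" "x \<noteq> 0"
    using weight_zero[of \<alpha>] by (metis singletonI subset_singletonD subsetI empty_iff)
  then show ?thesis using that assms by (simp add: root_system_def)
qed

lemma br_weight:
  assumes x: "x \<in> L i" "x \<in> weight \<alpha>" and y: "y \<in> weight \<beta>"
  shows "br x y \<in> weight (\<alpha> + \<beta>)"
  unfolding weight_space_def
proof safe
  fix h assume h: "h \<in> H"
  then have "h \<in> L 0" using H_even by auto
  from super_jacobi[OF this x(1), of y] h x y
  show "br h (br x y) = scale ((\<alpha> + \<beta>) h) (br x y)"
    by (simp add: weight_space_def br_scale_left br_scale_right scale_left_distrib)
qed

lemma weight_decomposition:
  obtains f where "\<And>\<alpha>. f \<alpha> \<in> weight \<alpha>" "\<And>\<alpha>. \<alpha> \<notin> dual \<Longrightarrow> f \<alpha> = 0"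
    "finite {\<alpha>. f \<alpha> \<noteq> 0}" "x = (\<Sum>\<alpha>\<in>{\<alpha>. f \<alpha> \<noteq> 0}. f \<alpha>)"
proof -
  obtain f where f: "\<And>\<alpha>. \<alpha> \<in> dual \<Longrightarrow> f \<alpha> \<in> weight \<alpha>" "\<And>\<alpha>. \<alpha> \<notin> dual \<Longrightarrow> f \<alpha> = 0"
    "finite {\<alpha>. f \<alpha> \<noteq> 0}" "x = (\<Sum>\<alpha>\<in>{\<alpha>. f \<alpha> \<noteq> 0}. f \<alpha>)"
    by (rule direct_sum_decomposition_exists[OF weight_space_decomposition, of x]) blast
  have "f \<alpha> \<in> weight \<alpha>" for \<alpha>
    using f(1,2) by (cases "\<alpha> \<in> dual") simp_all
  then show ?thesis using that f by blast
qed

lemma br_H_central: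
  assumes h: "h \<in> H" and k: "k \<in> H"
  shows "br (br h k) z = 0"
proof -
  have w: "br (br h k) z = 0" if "z \<in> weight \<alpha>" for z \<alpha>
  proof -
    have "h \<in> L 0" "k \<in> L 0" using h k H_even by auto
    from super_jacobi[OF this, of z] h k that show ?thesis
      by (simp add: weight_space_def br_scale_right mult.commute)
  qed
  obtain f where f: "\<And>\<alpha>. f \<alpha> \<in> weight \<alpha>" "z = (\<Sum>\<alpha>\<in>{\<alpha>. f \<alpha> \<noteq> 0}. f \<alpha>)"
    by (rule weight_decomposition[of z]) blast
  show ?thesis
    using w[OF f(1)] by (subst f(2)) (simp add: br_sum_right)
qed

text \<open>
  By centrality of \<open>[H, H]\<close>, \<open>(ad h)\<^sup>2\<close> kills \<open>H\<close>; as \<open>ad h\<close> is diagonalisable, so does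
  \<open>ad h\<close>.
\<close>

lemma H_abelian:
  assumes h: "h \<in> H" and k: "k \<in> H"
  shows "br h k = 0"
proof -
  obtain f where f: "\<And>\<alpha>. f \<alpha> \<in> weight \<alpha>" "\<And>\<alpha>. \<alpha> \<notin> dual \<Longrightarrow> f \<alpha> = 0"
    "finite {\<alpha>. f \<alpha> \<noteq> 0}" "k = (\<Sum>\<alpha>\<in>{\<alpha>. f \<alpha> \<noteq> 0}. f \<alpha>)"
    by (rule weight_decomposition[of k]) blast
  have hf: "br h (f \<alpha>) = scale (\<alpha> h) (f \<alpha>)" for \<alpha>
    using f(1)[of \<alpha>] h by (simp add: weight_space_def)
  have "br h k \<in> L 0" "h \<in> L 0" using H_br_closed[OF h k] h H_even by auto
  then have "br h (br h k) = - br (br h k) h"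
    using super_antisymmetry[of h 0 "br h k" 0] by simp
  then have 0: "br h (br h k) = 0"
    using br_H_central[OF h k] by simp
  have "scale (\<alpha> h * \<alpha> h) (f \<alpha>) = 0" for \<alpha>
  proof (rule direct_sum_decomposition_zero[OF weight_space_decomposition _ _ _ f(3)])
    show "(\<Sum>\<alpha>\<in>{\<alpha>. f \<alpha> \<noteq> 0}. scale (\<alpha> h * \<alpha> h) (f \<alpha>)) = 0"
      using 0 by (subst (asm) f(4)) (simp add: br_sum_right hf br_scale_right)
  qed (use f in \<open>auto intro: weight_scale\<close>)
  then have "br h (f \<alpha>) = 0" for \<alpha>
    unfolding hf by (metis mult_eq_0_iff scale_eq_0_iff)
  then show ?thesis
    by (subst f(4)) (simp add: br_sum_right)
qed

lemma zero_root: "0 \<in> roots"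
proof -
  obtain h where "h \<in> H" "h \<noteq> 0"
    using H_nonzero subspace_0[OF H_subspace] by blast
  then show ?thesis
    by (intro rootI[of _ h]) (auto simp: dual_space_def weight_space_def H_abelian)
qed

lemma root_graded:
  assumes "\<alpha> \<in> roots"
  obtains i where "\<alpha> \<in> graded_root_system scale L br H i"
proof -
  obtain x where x: "\<alpha> \<in> dual" "x \<in> weight \<alpha>" "x \<noteq> 0" by (rule rootE[OF assms])
  obtain x0 x1 where xx: "x0 \<in> L 0" "x1 \<in> L 1" "x = x0 + x1" by (rule graded_components)
  have "br h x0 = scale (\<alpha> h) x0 \<and> br h x1 = scale (\<alpha> h) x1" if h: "h \<in> H" for h
  proof -
    have h0: "h \<in> L 0" using h H_even by auto
    have "br h x0 + br h x1 = scale (\<alpha> h) x0 + scale (\<alpha> h) x1"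
      using x(2) h unfolding xx(3) by (simp add: weight_space_def br_add_right scale_right_distrib)
    then have "(br h x0 - scale (\<alpha> h) x0) + (br h x1 - scale (\<alpha> h) x1) = 0"
      by (simp add: algebra_simps)
    moreover have "br h x0 - scale (\<alpha> h) x0 \<in> L 0" "br h x1 - scale (\<alpha> h) x1 \<in> L 1"
      using br_graded[OF h0 xx(1)] br_graded[OF h0 xx(2)] xx(1,2)
      by (auto intro!: subspace_diff subspace_scale grading_subspace)
    ultimately show ?thesis using graded_independent by (metis right_minus_eq)
  qed
  then have "x0 \<in> weight \<alpha>" "x1 \<in> weight \<alpha>" by (auto simp: weight_space_def)
  moreover have "x0 \<noteq> 0 \<or> x1 \<noteq> 0" using x xx by auto
  ultimately show ?thesis
    using that[of 0] that[of 1] x(1) xx(1,2) by (auto simp: graded_root_system_def)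
qed

lemma B_simps:
  "B x (y + z) = B x y + B x z" "B (x + y) z = B x z + B y z"
  "B x (scale c y) = c * B x y" "B (scale c x) y = c * B x y"
  using B_linear_right B_linear_left by (simp_all add: Vector_Spaces.linear_iff)

lemma B_minus: "B (- x) y = - B x y" "B x (- y) = - B x y"
  using B_simps(4)[of "- 1" x y] B_simps(3)[of x "- 1" y] by simp_all

lemma B_diff: "B (x - y) z = B x z - B y z"
  using B_simps(2)[of x "- y" z] by (simp add: B_minus)

lemma B_br_weight:
  assumes y: "y \<in> L i" "y \<in> weight (- \<alpha>)" and h: "h \<in> H"
  shows "B (br x y) h = B x y * \<alpha> h"
proof -
  have "h \<in> L 0" using h H_even by auto
  then have "br y h = scale (\<alpha> h) y"
    using super_antisymmetry[OF y(1), of h 0] y(2) h by (simp add: weight_space_def)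
  then show ?thesis by (simp add: B_invariant B_simps)
qed

definition represented :: "('v \<Rightarrow> 'f) set" where
  "represented = {\<alpha>. (\<exists>t\<in>H. \<forall>h\<in>H. \<alpha> h = B t h) \<and> (\<forall>h. h \<notin> H \<longrightarrow> \<alpha> h = 0)}"

abbreviation t where "t \<equiv> dual_vector H B"
abbreviation form where "form \<equiv> dual_form H B"

lemma dual_vector_eqI:
  assumes "s \<in> H" "\<And>h. h \<in> H \<Longrightarrow> \<alpha> h = B s h"
  shows "t \<alpha> = s"
  unfolding dual_vector_def
proof (rule the_equality)
  fix u assume u: "u \<in> H \<and> (\<forall>h\<in>H. \<alpha> h = B u h)"
  have "u - s = 0"
    by (rule B_nondegenerate_H) (use u assms H_subspace in \<open>auto simp: B_diff intro: subspace_diff\<close>)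
  then show "u = s" by simp
qed (use assms in blast)

lemma dual_vector:
  assumes "\<alpha> \<in> represented"
  shows "t \<alpha> \<in> H" "\<And>h. h \<in> H \<Longrightarrow> \<alpha> h = B (t \<alpha>) h"
proof -
  obtain s where s: "s \<in> H" "\<And>h. h \<in> H \<Longrightarrow> \<alpha> h = B s h"
    using assms unfolding represented_def by blast
  then have "t \<alpha> = s" by (rule dual_vector_eqI)
  then show "t \<alpha> \<in> H" "\<And>h. h \<in> H \<Longrightarrow> \<alpha> h = B (t \<alpha>) h"
    using s by simp_all
qed

lemma form_apply: "\<alpha> \<in> represented \<Longrightarrow> \<beta> \<in> represented \<Longrightarrow> form \<alpha> \<beta> = \<alpha> (t \<beta>)"
  by (simp add: dual_form_def dual_vector)

lemma form_commute: "\<alpha> \<in> represented \<Longrightarrow> \<beta> \<in> represented \<Longrightarrow> form \<alpha> \<beta> = form \<beta> \<alpha>"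
  using B_supersymmetric[of "t \<alpha>" 0 "t \<beta>" 0] dual_vector(1) H_even by (auto simp: dual_form_def)

lemma represented_closed:
  "0 \<in> represented"
  "\<alpha> \<in> represented \<Longrightarrow> - \<alpha> \<in> represented"
  "\<alpha> \<in> represented \<Longrightarrow> \<beta> \<in> represented \<Longrightarrow> \<alpha> + \<beta> \<in> represented"
  "\<alpha> \<in> represented \<Longrightarrow> \<beta> \<in> represented \<Longrightarrow> \<alpha> - \<beta> \<in> represented"
proof -
  show 0: "0 \<in> represented"
    using B_simps(4)[of 0 0] subspace_0[OF H_subspace]
    by (auto simp: represented_def intro!: bexI[of _ 0])
  show m: "- \<alpha> \<in> represented" if "\<alpha> \<in> represented" for \<alpha>
    using that dual_vector[OF that] subspace_neg[OF H_subspace]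
    by (auto simp: represented_def B_minus intro!: bexI[of _ "- t \<alpha>"])
  show p: "\<alpha> + \<beta> \<in> represented" if "\<alpha> \<in> represented" "\<beta> \<in> represented" for \<alpha> \<beta>
    using that dual_vector[OF that(1)] dual_vector[OF that(2)] subspace_add[OF H_subspace]
    by (auto simp: represented_def B_simps intro!: bexI[of _ "t \<alpha> + t \<beta>"])
  show "\<alpha> - \<beta> \<in> represented" if "\<alpha> \<in> represented" "\<beta> \<in> represented"
    using p[OF that(1) m[OF that(2)]] by simp
qed

lemma represented_int_multiple:
  assumes "\<alpha> \<in> represented"
  shows "int_multiple k \<alpha> \<in> represented"
proof (induction k rule: int_induct[of _ 0])
  case base
  show ?case unfolding int_multiple_simps by (rule represented_closed)
next
  case (step1 k)
  then show ?case unfolding int_multiple_simps using assms by (intro represented_closed)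
next
  case (step2 k)
  then show ?case unfolding int_multiple_simps using assms by (intro represented_closed)
qed

lemma form_add:
  assumes "\<alpha> \<in> represented" "\<beta> \<in> represented" "\<gamma> \<in> represented"
  shows "form (\<alpha> + \<beta>) \<gamma> = form \<alpha> \<gamma> + form \<beta> \<gamma>" "form \<gamma> (\<alpha> + \<beta>) = form \<gamma> \<alpha> + form \<gamma> \<beta>"
proof -
  show "form (\<alpha> + \<beta>) \<gamma> = form \<alpha> \<gamma> + form \<beta> \<gamma>"
    using assms by (simp add: form_apply represented_closed)
  then show "form \<gamma> (\<alpha> + \<beta>) = form \<gamma> \<alpha> + form \<gamma> \<beta>"
    using assms form_commute[of \<gamma>] by (simp add: represented_closed)
qed

lemma form_minus:
  assumes "\<alpha> \<in> represented" "\<beta> \<in> represented"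
  shows "form (- \<alpha>) \<beta> = - form \<alpha> \<beta>" "form \<beta> (- \<alpha>) = - form \<beta> \<alpha>"
proof -
  show "form (- \<alpha>) \<beta> = - form \<alpha> \<beta>"
    using assms by (simp add: form_apply represented_closed)
  then show "form \<beta> (- \<alpha>) = - form \<beta> \<alpha>"
    using assms form_commute[of \<beta>] by (simp add: represented_closed)
qed

lemma form_int_multiple:
  assumes "\<alpha> \<in> represented" "\<beta> \<in> represented"
  shows "form (int_multiple k \<alpha>) \<beta> = of_int k * form \<alpha> \<beta>"
    "form \<beta> (int_multiple k \<alpha>) = of_int k * form \<beta> \<alpha>"
proof -
  show "form (int_multiple k \<alpha>) \<beta> = of_int k * form \<alpha> \<beta>"
    using assms by (simp add: form_apply represented_int_multiple int_multiple_apply)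
  then show "form \<beta> (int_multiple k \<alpha>) = of_int k * form \<beta> \<alpha>"
    using assms form_commute[of \<beta>] by (simp add: represented_int_multiple)
qed

end

context extended_affine_lie_superalgebra
begin

lemma root_vectors:
  assumes \<alpha>: "\<alpha> \<in> roots" "\<alpha> \<noteq> 0"
  obtains i x y c where "x \<in> L i" "x \<in> weight \<alpha>" "y \<in> L i" "y \<in> weight (- \<alpha>)"
    "c \<noteq> 0" "br x y = scale c (t \<alpha>)" "y \<noteq> 0" "\<alpha> \<in> represented"
proof -
  obtain i where "\<alpha> \<in> graded_root_system scale L br H i" by (rule root_graded[OF \<alpha>(1)])
  then obtain x y where xy: "x \<in> L i" "x \<in> weight \<alpha>" "y \<in> L i" "y \<in> weight (- \<alpha>)"
    "br x y \<noteq> 0" "br x y \<in> H"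
    using opposite_root_vectors[of \<alpha> i] \<alpha>(2) by blast
  have B: "B (br x y) h = B x y * \<alpha> h" if "h \<in> H" for h
    using B_br_weight xy that by blast
  have c: "B x y \<noteq> 0"
    using B_nondegenerate_H[OF xy(6)] B xy(5) by auto
  let ?s = "scale (inverse (B x y)) (br x y)"
  have s: "?s \<in> H" "\<And>h. h \<in> H \<Longrightarrow> \<alpha> h = B ?s h"
    using xy(6) H_subspace B c by (auto simp: B_simps intro: subspace_scale)
  then have "t \<alpha> = ?s" by (rule dual_vector_eqI)
  then have "br x y = scale (B x y) (t \<alpha>)" using c by simp
  moreover have "\<alpha> \<in> represented"
    using s \<alpha>(1) by (auto simp: represented_def root_system_def dual_space_def)
  moreover have "y \<noteq> 0" using xy(5) by auto
  ultimately show ?thesis using that xy c by blast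
qed

lemma root_represented: "\<alpha> \<in> roots \<Longrightarrow> \<alpha> \<in> represented"
  by (cases "\<alpha> = 0") (auto simp: represented_closed elim: root_vectors)

lemma root_minus:
  assumes "\<alpha> \<in> roots"
  shows "- \<alpha> \<in> roots"
proof (cases "\<alpha> = 0")
  case False
  have "\<alpha> \<in> dual" using assms by (simp add: root_system_def)
  then have "- \<alpha> \<in> dual" by (rule dual_space_closed(2))
  then show ?thesis using root_vectors[OF assms False] rootI by metis
qed (use zero_root in simp)

lemma form_zero: "form 0 0 = 0"
  using form_minus[of 0 0] form_add[of 0 0 0] by (simp add: represented_closed)

lemma root_plus_or_minus:
  assumes \<alpha>: "\<alpha> \<in> roots" "\<alpha> \<noteq> 0" and \<beta>: "\<beta> \<in> roots" and "form \<alpha> \<beta> \<noteq> 0"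
  shows "\<beta> - \<alpha> \<in> roots \<or> \<beta> + \<alpha> \<in> roots"
proof -
  obtain i x y c where xy: "x \<in> L i" "x \<in> weight \<alpha>" "y \<in> L i" "y \<in> weight (- \<alpha>)"
    "c \<noteq> 0" "br x y = scale c (t \<alpha>)" "\<alpha> \<in> represented"
    by (rule root_vectors[OF \<alpha>]) blast
  obtain z where z: "\<beta> \<in> dual" "z \<in> weight \<beta>" "z \<noteq> 0" by (rule rootE[OF \<beta>])
  have "form \<beta> \<alpha> \<noteq> 0" using assms form_commute root_represented by metis
  then have "\<beta> (t \<alpha>) \<noteq> 0" using form_apply root_represented \<alpha> \<beta> by metis
  then have "br (br x y) z \<noteq> 0"
    using xy z dual_vector(1)[of \<alpha>] by (simp add: br_scale_left weight_space_def)
  then have "br x (br y z) \<noteq> scale (super_sign i i) (br y (br x z))"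
    using super_jacobi[OF xy(1,3), of z] by simp
  then have "br y z \<noteq> 0 \<or> br x z \<noteq> 0" by auto
  moreover have "br y z \<in> weight (- \<alpha> + \<beta>)" "br x z \<in> weight (\<alpha> + \<beta>)"
    using br_weight xy z by blast+
  moreover have "- \<alpha> + \<beta> \<in> dual" "\<alpha> + \<beta> \<in> dual"
    using z(1) \<alpha>(1) by (auto simp: root_system_def intro: dual_space_closed)
  ultimately have "- \<alpha> + \<beta> \<in> roots \<or> \<alpha> + \<beta> \<in> roots" using rootI by blast
  then show ?thesis by (simp add: add.commute)
qed

lemma highest_weight_vector:
  assumes \<alpha>: "\<alpha> \<in> roots" "form \<alpha> \<alpha> \<noteq> 0"
    and xy: "x \<in> L i" "x \<in> weight \<alpha>" "y \<in> L i" "y \<in> weight (- \<alpha>)"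
      "c \<noteq> 0" "br x y = scale c (t \<alpha>)"
    and w: "\<gamma> \<in> roots" "w \<in> weight \<gamma>" "w \<noteq> 0" and xw: "br x w = 0"
  obtains j :: nat where "2 * form \<gamma> \<alpha> = of_nat j * form \<alpha> \<alpha>"
    "\<And>i. i \<le> j \<Longrightarrow> \<gamma> - int_multiple (int i) \<alpha> \<in> roots"
proof -
  have r: "\<alpha> \<in> represented" "\<gamma> \<in> represented" using \<alpha> w root_represented by auto
  have dual: "\<alpha> \<in> dual" "\<gamma> \<in> dual" using \<alpha> w by (auto simp: root_system_def)
  define v where "v j = (br y ^^ j) w" for j
  have v_weight: "v j \<in> weight (\<gamma> - int_multiple (int j) \<alpha>)" for j
  proof (induction j)
    case (Suc j)
    have "v (Suc j) = br y (v j)" by (simp add: v_def)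
    moreover have "- \<alpha> + (\<gamma> - int_multiple (int j) \<alpha>) = \<gamma> - int_multiple (int (Suc j)) \<alpha>"
      by (auto simp: fun_eq_iff int_multiple_apply algebra_simps)
    ultimately show ?case using br_weight[OF xy(3,4) Suc] by metis
  qed (simp add: v_def w int_multiple_simps)
  define l where "l = c * form \<gamma> \<alpha>"
  define a where "a = c * form \<alpha> \<alpha>"
  define s :: 'f where "s = super_sign i i"
  have hv: "br (br x y) (v j) = scale (l - of_nat j * a) (v j)" for j
  proof -
    have "br (t \<alpha>) (v j) = scale (\<gamma> (t \<alpha>) - of_nat j * \<alpha> (t \<alpha>)) (v j)"
      using v_weight[of j] dual_vector(1)[OF r(1)] by (simp add: weight_space_def int_multiple_apply)
    then show ?thesis
      unfolding xy(6) br_scale_left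
      by (simp add: l_def a_def form_apply r right_diff_distrib mult.left_commute)
  qed
  have jac: "br x (v (Suc j)) = scale (l - of_nat j * a) (v j) + scale s (br y (br x (v j)))" for j
    using super_jacobi[OF xy(1,3), of "v j"] unfolding hv s_def by (simp add: v_def)
  define d where "d = rec_nat l (\<lambda>j e. l - of_nat (Suc j) * a + s * e)"
  have d: "d 0 = l" "d (Suc j) = l - of_nat (Suc j) * a + s * d j" for j
    by (simp_all add: d_def)
  have xv: "br x (v (Suc j)) = scale (d j) (v j)" for j
  proof (induction j)
    case 0
    have "v 0 = w" by (simp add: v_def)
    then show ?case using jac[of 0] xw by (simp add: d)
  next
    case (Suc j)
    have "br y (br x (v (Suc j))) = scale (d j) (v (Suc j))"
      unfolding Suc by (simp add: br_scale_right v_def)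
    then show ?case unfolding jac[of "Suc j"] d by (simp add: scale_left_distrib)
  qed
  have "form (- \<alpha>) (- \<alpha>) \<noteq> 0"
    using \<alpha>(2) r by (simp add: form_minus represented_closed)
  then obtain N where "v N = 0"
    using ad_locally_nilpotent[OF root_minus[OF \<alpha>(1)] _ xy(4)] unfolding v_def by blast
  define M where "M = (LEAST N. v N = 0)"
  have M: "v M = 0" "\<And>j. j < M \<Longrightarrow> v j \<noteq> 0"
    using LeastI[of "\<lambda>N. v N = 0", OF \<open>v N = 0\<close>] not_less_Least[of _ "\<lambda>N. v N = 0"]
    unfolding M_def by blast+
  have "M \<noteq> 0"
  proof
    assume "M = 0"
    then show False using M(1) w(3) by (simp add: v_def)
  qed
  then obtain j where j: "M = Suc j" by (cases M) auto
  have "d j = 0" using xv[of j] M j by simp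
  moreover have "a \<noteq> 0" using xy(5) \<alpha>(2) by (simp add: a_def)
  moreover have "s = 1 \<or> s = - 1" by (simp add: s_def super_sign_def)
  ultimately have "2 * l = of_nat j * a"
    using ladder_vanishing[OF d] by blast
  then have "c * (2 * form \<gamma> \<alpha>) = c * (of_nat j * form \<alpha> \<alpha>)"
    by (simp add: l_def a_def algebra_simps)
  then have 1: "2 * form \<gamma> \<alpha> = of_nat j * form \<alpha> \<alpha>" using xy(5) by simp
  have "\<gamma> - int_multiple (int i) \<alpha> \<in> roots" if "i \<le> j" for i
  proof (rule rootI[OF _ v_weight])
    have "int_multiple (int i) \<alpha> \<in> dual"
      using dual(1) by (auto simp: dual_space_def int_multiple_apply algebra_simps)
    then show "\<gamma> - int_multiple (int i) \<alpha> \<in> dual" using dual_space_closed dual(2) by blast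
    show "v i \<noteq> 0" using M(2) that j by simp
  qed
  then show ?thesis using that 1 by blast
qed

lemma highest_weight:
  assumes \<alpha>: "\<alpha> \<in> roots" "form \<alpha> \<alpha> \<noteq> 0" and \<gamma>: "\<gamma> \<in> roots"
    and top: "\<gamma> + \<alpha> \<notin> roots"
  obtains j :: nat where "2 * form \<gamma> \<alpha> = of_nat j * form \<alpha> \<alpha>"
    "\<And>i. i \<le> j \<Longrightarrow> \<gamma> - int_multiple (int i) \<alpha> \<in> roots"
proof -
  have "\<alpha> \<noteq> 0" using \<alpha> form_zero by auto
  then obtain i x y c where xy: "x \<in> L i" "x \<in> weight \<alpha>" "y \<in> L i" "y \<in> weight (- \<alpha>)"
    "c \<noteq> 0" "br x y = scale c (t \<alpha>)"
    using root_vectors[OF \<alpha>(1)] by metis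
  obtain w where w: "\<gamma> \<in> dual" "w \<in> weight \<gamma>" "w \<noteq> 0" by (rule rootE[OF \<gamma>])
  have "\<alpha> \<in> dual" using \<alpha> by (simp add: root_system_def)
  then have "br x w \<noteq> 0 \<Longrightarrow> \<alpha> + \<gamma> \<in> roots"
    using br_weight[OF xy(1,2) w(2)] dual_space_closed(1) w(1) rootI by blast
  then have "br x w = 0" using top by (auto simp: add.commute)
  then show ?thesis
    using highest_weight_vector[OF \<alpha> xy \<gamma> w(2,3)] that by blast
qed

lemma lowest_weight:
  assumes \<alpha>: "\<alpha> \<in> roots" "form \<alpha> \<alpha> \<noteq> 0" and \<gamma>: "\<gamma> \<in> roots"
    and bot: "\<gamma> - \<alpha> \<notin> roots"
  obtains j :: nat where "2 * form \<gamma> \<alpha> = - of_nat j * form \<alpha> \<alpha>"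
    "\<And>i. i \<le> j \<Longrightarrow> \<gamma> + int_multiple (int i) \<alpha> \<in> roots"
proof -
  have r: "\<alpha> \<in> represented" "\<gamma> \<in> represented" using \<alpha> \<gamma> root_represented by auto
  have "form (- \<alpha>) (- \<alpha>) \<noteq> 0" "\<gamma> + - \<alpha> \<notin> roots"
    using \<alpha>(2) bot r by (simp_all add: form_minus represented_closed)
  then obtain j :: nat where "2 * form \<gamma> (- \<alpha>) = of_nat j * form (- \<alpha>) (- \<alpha>)"
    "\<And>i. i \<le> j \<Longrightarrow> \<gamma> - int_multiple (int i) (- \<alpha>) \<in> roots"
    using highest_weight[OF root_minus[OF \<alpha>(1)] _ \<gamma>] by metis
  then have "2 * form \<gamma> \<alpha> = - of_nat j * form \<alpha> \<alpha>" "\<And>i. i \<le> j \<Longrightarrow> \<gamma> + int_multiple (int i) \<alpha> \<in> roots"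
    using r by (simp_all add: form_minus represented_closed int_multiple_simps minus_equation_iff)
  then show ?thesis by (rule that)
qed

lemma root_integrality:
  assumes \<alpha>: "\<alpha> \<in> roots" "form \<alpha> \<alpha> \<noteq> 0" and \<beta>: "\<beta> \<in> roots"
  obtains n :: int where "2 * form \<beta> \<alpha> = of_int n * form \<alpha> \<alpha>"
proof -
  have r: "\<alpha> \<in> represented" "\<beta> \<in> represented" using \<alpha> \<beta> root_represented by auto
  have "\<alpha> \<noteq> 0" using \<alpha> form_zero by auto
  then obtain i x y c where xy: "x \<in> L i" "x \<in> weight \<alpha>" "y \<in> L i" "y \<in> weight (- \<alpha>)"
    "c \<noteq> 0" "br x y = scale c (t \<alpha>)"
    using root_vectors[OF \<alpha>(1)] by metis
  obtain z where z: "\<beta> \<in> dual" "z \<in> weight \<beta>" "z \<noteq> 0" by (rule rootE[OF \<beta>])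
  define w where "w k = (br x ^^ k) z" for k
  have w: "w k \<in> weight (\<beta> + int_multiple (int k) \<alpha>)" for k
  proof (induction k)
    case (Suc k)
    have "w (Suc k) = br x (w k)" by (simp add: w_def)
    moreover have "\<alpha> + (\<beta> + int_multiple (int k) \<alpha>) = \<beta> + int_multiple (int (Suc k)) \<alpha>"
      by (auto simp: fun_eq_iff int_multiple_apply algebra_simps)
    ultimately show ?case using br_weight[OF xy(1,2) Suc] by metis
  qed (simp add: w_def z int_multiple_simps)
  obtain N where "w N = 0"
    using ad_locally_nilpotent[OF \<alpha> xy(2)] unfolding w_def by blast
  moreover have "w 0 \<noteq> 0" using z by (simp add: w_def)
  ultimately obtain k where k: "w k \<noteq> 0" "w (Suc k) = 0"
    by (induction N) auto
  let ?\<gamma> = "\<beta> + int_multiple (int k) \<alpha>"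
  have "\<alpha> \<in> dual" using \<alpha> by (simp add: root_system_def)
  then have "int_multiple (int k) \<alpha> \<in> dual"
    by (auto simp: dual_space_def int_multiple_apply algebra_simps)
  then have "?\<gamma> \<in> roots"
    using dual_space_closed(1) z(1) rootI[OF _ w k(1)] by blast
  moreover have "br x (w k) = 0" using k(2) by (simp add: w_def)
  ultimately obtain j :: nat where "2 * form ?\<gamma> \<alpha> = of_nat j * form \<alpha> \<alpha>"
    using highest_weight_vector[OF \<alpha> xy _ w k(1)] by metis
  then have "2 * form \<beta> \<alpha> = of_int (int j - 2 * int k) * form \<alpha> \<alpha>"
    using r by (simp add: form_add represented_int_multiple form_int_multiple algebra_simps)
  then show ?thesis by (rule that)
qed

lemma finite_root_string:
  assumes \<alpha>: "\<alpha> \<in> roots" "form \<alpha> \<alpha> \<noteq> 0" and \<beta>: "\<beta> \<in> roots"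
  shows "finite {k. \<beta> + int_multiple k \<alpha> \<in> roots}"
proof -
  have r: "\<alpha> \<in> represented" "\<beta> \<in> represented" using \<alpha> \<beta> root_represented by auto
  obtain n :: int where n: "2 * form \<beta> \<alpha> = of_int n * form \<alpha> \<alpha>"
    by (rule root_integrality[OF \<alpha> \<beta>])
  have "2 * form \<alpha> \<beta> = of_int n * form \<alpha> \<alpha>" using n form_commute[OF r] by simp
  define q where "q = form \<beta> \<beta> / form \<alpha> \<alpha>"
  show ?thesis
  proof (rule finite_integral_quadratic_quotients[where r = q and n = n])
    fix k assume "k \<in> {k. \<beta> + int_multiple k \<alpha> \<in> roots}"
    then have \<gamma>: "\<beta> + int_multiple k \<alpha> \<in> roots" (is "?\<gamma> \<in> _") by simp
    have "form ?\<gamma> ?\<gamma> = form \<beta> \<beta> + of_int k * (2 * form \<beta> \<alpha>) + of_int (k * k) * form \<alpha> \<alpha>"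
      using r form_commute[OF r]
      by (simp add: form_add represented_int_multiple represented_closed form_int_multiple algebra_simps)
    also have "\<dots> = form \<alpha> \<alpha> * (q + of_int (n * k + k * k))"
      using \<alpha>(2) by (simp add: n q_def algebra_simps)
    finally have len: "form ?\<gamma> ?\<gamma> = form \<alpha> \<alpha> * (q + of_int (n * k + k * k))" .
    have pair: "2 * form \<alpha> ?\<gamma> = form \<alpha> \<alpha> * of_int (n + 2 * k)"
      using r n form_commute[OF r]
      by (simp add: form_add represented_int_multiple form_int_multiple algebra_simps)
    show "q + of_int (n * k + k * k) = 0 \<or>
      (\<exists>m::int. of_int (n + 2 * k) = of_int m * (q + of_int (n * k + k * k)))"
    proof (cases "form ?\<gamma> ?\<gamma> = 0")
      case True
      then show ?thesis using \<alpha>(2) unfolding len by (metis mult_eq_0_iff)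
    next
      case False
      obtain m :: int where "2 * form \<alpha> ?\<gamma> = of_int m * form ?\<gamma> ?\<gamma>"
        by (rule root_integrality[OF \<gamma> False \<alpha>(1)])
      then have "form \<alpha> \<alpha> * of_int (n + 2 * k) = form \<alpha> \<alpha> * (of_int m * (q + of_int (n * k + k * k)))"
        unfolding pair len by (simp only: mult_ac)
      then show ?thesis using \<alpha>(2) mult_left_cancel by blast
    qed
  qed
qed

lemma root_string:
  assumes \<alpha>: "\<alpha> \<in> roots" "form \<alpha> \<alpha> \<noteq> 0" and \<beta>: "\<beta> \<in> roots"
  obtains p q :: nat where "2 * form \<beta> \<alpha> = (of_nat p - of_nat q) * form \<alpha> \<alpha>"
    "\<And>k. \<beta> + int_multiple k \<alpha> \<in> roots \<longleftrightarrow> - int p \<le> k \<and> k \<le> int q"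
proof -
  have r: "\<alpha> \<in> represented" "\<beta> \<in> represented" using \<alpha> \<beta> root_represented by auto
  define S where "S = {k. \<beta> + int_multiple k \<alpha> \<in> roots}"
  have S: "finite S" "0 \<in> S"
    using finite_root_string[OF assms] \<beta> by (simp_all add: S_def int_multiple_simps)
  have mem_S: "k \<in> S \<longleftrightarrow> \<beta> + int_multiple k \<alpha> \<in> roots" for k
    by (simp add: S_def)
  have "S \<noteq> {}" using S(2) by blast
  note M = Max_in[OF S(1) this] Min_in[OF S(1) this] Max_ge[OF S] Min_le[OF S]
  obtain n :: int where n: "2 * form \<beta> \<alpha> = of_int n * form \<alpha> \<alpha>"
    by (rule root_integrality[OF \<alpha> \<beta>])
  have pair: "2 * form (\<beta> + int_multiple k \<alpha>) \<alpha> = of_int (n + 2 * k) * form \<alpha> \<alpha>" for k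
    using r n by (simp add: form_add represented_int_multiple form_int_multiple algebra_simps)
  have cancel: "k = l" if "of_int k * form \<alpha> \<alpha> = of_int l * form \<alpha> \<alpha>" for k l
    using that \<alpha>(2) by simp
  have "Max S + 1 \<notin> S" "Min S - 1 \<notin> S"
    using S Max_ge[of S "Max S + 1"] Min_le[of S "Min S - 1"] by auto
  then have ends: "\<beta> + int_multiple (Max S) \<alpha> + \<alpha> \<notin> roots" "\<beta> + int_multiple (Min S) \<alpha> - \<alpha> \<notin> roots"
    by (simp_all add: S_def int_multiple_simps add.assoc add_diff_eq)
  obtain j :: nat where j: "2 * form (\<beta> + int_multiple (Max S) \<alpha>) \<alpha> = of_nat j * form \<alpha> \<alpha>"
    "\<And>i. i \<le> j \<Longrightarrow> \<beta> + int_multiple (Max S) \<alpha> - int_multiple (int i) \<alpha> \<in> roots"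
    by (rule highest_weight[OF \<alpha> _ ends(1)]) (use M in \<open>auto simp: S_def\<close>)
  obtain l :: nat where l: "2 * form (\<beta> + int_multiple (Min S) \<alpha>) \<alpha> = - of_nat l * form \<alpha> \<alpha>"
    "\<And>i. i \<le> l \<Longrightarrow> \<beta> + int_multiple (Min S) \<alpha> + int_multiple (int i) \<alpha> \<in> roots"
    by (rule lowest_weight[OF \<alpha> _ ends(2)]) (use M in \<open>auto simp: S_def\<close>)
  have j': "n + 2 * Max S = int j"
    using j(1) unfolding pair by (intro cancel) simp
  have l': "n + 2 * Min S = - int l"
    using l(1) unfolding pair by (intro cancel) simp
  have jS: "Max S - int i \<in> S" if "i \<le> j" for i
    using j(2)[OF that] by (simp add: S_def int_multiple_simps add_diff_eq)
  have lS: "Min S + int i \<in> S" if "i \<le> l" for i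
    using l(2)[OF that] by (simp add: S_def int_multiple_simps add.assoc)
  have "Min S \<le> Max S - int j" "Min S + int l \<le> Max S"
    using jS[of j] lS[of l] S by auto
  then have jl: "Max S - Min S = int j" "n = - Min S - Max S"
    using j' l' by auto
  have "k \<in> S \<longleftrightarrow> Min S \<le> k \<and> k \<le> Max S" for k :: int
  proof
    assume k: "Min S \<le> k \<and> k \<le> Max S"
    then have "nat (Max S - k) \<le> j" using jl by linarith
    from jS[OF this] k show "k \<in> S" by simp
  qed (use S in auto)
  then have "\<beta> + int_multiple k \<alpha> \<in> roots \<longleftrightarrow> - int (nat (- Min S)) \<le> k \<and> k \<le> int (nat (Max S))" for k
    using M(3,4) by (simp flip: mem_S)
  moreover have "2 * form \<beta> \<alpha> = (of_nat (nat (- Min S)) - of_nat (nat (Max S))) * form \<alpha> \<alpha>"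
    unfolding n jl(2) using M by simp
  ultimately show ?thesis using that by blast
qed

lemma root_group_represented: "group_closure roots \<subseteq> represented"
proof
  fix \<alpha> assume "\<alpha> \<in> group_closure roots"
  then show "\<alpha> \<in> represented"
  proof induction
    case (base s)
    then show ?case using root_represented represented_closed(1) by blast
  qed (rule represented_closed)
qed

lemma root_supersystem:
  "extended_affine_root_supersystem_conditions (group_closure roots) form roots"
proof
  fix a b c assume "a \<in> group_closure roots" "b \<in> group_closure roots" "c \<in> group_closure roots"
  then have "a \<in> represented" "b \<in> represented" "c \<in> represented"
    using root_group_represented by auto
  then show "form (a + b) c = form a c + form b c" "form a (b + c) = form a b + form a c"
    by (simp_all add: form_add)
next
  fix a b assume "a \<in> group_closure roots" "b \<in> group_closure roots"
  then show "form a b = form b a"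
    using root_group_represented form_commute by blast
next
  show "0 \<in> roots" by (rule zero_root)
  show "group_closure roots = group_closure roots" ..
  show "uminus ` roots = roots"
    using root_minus by (auto intro!: image_eqI[where x = "- x" for x])
next
  fix \<alpha> \<beta> assume \<alpha>: "\<alpha> \<in> real_roots_nonzero form roots" and \<beta>: "\<beta> \<in> roots"
  then have \<alpha>: "\<alpha> \<in> roots" "form \<alpha> \<alpha> \<noteq> 0" by (auto simp: real_roots_nonzero_def)
  obtain n :: int where "2 * form \<beta> \<alpha> = of_int n * form \<alpha> \<alpha>"
    by (rule root_integrality[OF \<alpha> \<beta>])
  then have "2 * form \<alpha> \<beta> / form \<alpha> \<alpha> = of_int n"
    using \<alpha>(2) form_commute root_represented \<alpha>(1) \<beta> by simp
  then show "2 * form \<alpha> \<beta> / form \<alpha> \<alpha> \<in> \<int>" by simp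
  obtain p q :: nat where pq: "2 * form \<beta> \<alpha> = (of_nat p - of_nat q) * form \<alpha> \<alpha>"
    "\<And>k. \<beta> + int_multiple k \<alpha> \<in> roots \<longleftrightarrow> - int p \<le> k \<and> k \<le> int q"
    by (rule root_string[OF \<alpha> \<beta>]) blast
  then have "2 * form \<beta> \<alpha> / form \<alpha> \<alpha> = of_nat p - of_nat q" using \<alpha>(2) by simp
  moreover have "{\<beta> + int_multiple k \<alpha> | k. True} \<inter> roots =
      {\<beta> + int_multiple k \<alpha> | k. - int p \<le> k \<and> k \<le> int q}"
    using pq(2) by blast
  ultimately show "\<exists>p q :: nat. 2 * form \<beta> \<alpha> / form \<alpha> \<alpha> = of_nat p - of_nat q \<and>
      {\<beta> + int_multiple k \<alpha> | k. True} \<inter> roots =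
      {\<beta> + int_multiple k \<alpha> | k. - int p \<le> k \<and> k \<le> int q}"
    by blast
next
  fix \<alpha> \<beta> assume \<alpha>: "\<alpha> \<in> nonsingular_roots (group_closure roots) form roots"
    and \<beta>: "\<beta> \<in> roots" and nz: "form \<alpha> \<beta> \<noteq> 0"
  have "\<alpha> \<in> roots" using \<alpha> zero_root by (auto simp: nonsingular_roots_def)
  moreover have "\<alpha> \<noteq> 0"
    using nz \<beta> form_apply[of 0 \<beta>] root_represented represented_closed(1) by auto
  ultimately show "{\<beta> - \<alpha>, \<beta> + \<alpha>} \<inter> roots \<noteq> {}"
    using root_plus_or_minus \<beta> nz by blast
qed

end

theorem corollary3p9:
  fixes scale :: "'f::field_char_0 \<Rightarrow> 'v::ab_group_add \<Rightarrow> 'v"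
    and L :: "bit \<Rightarrow> 'v set"
    and br :: "'v \<Rightarrow> 'v \<Rightarrow> 'v"
    and H :: "'v set"
    and B :: "'v \<Rightarrow> 'v \<Rightarrow> 'f"
    and R :: "('v \<Rightarrow> 'f) set"
  assumes "extended_affine_lie_superalgebra scale L br H B"
    and "R = root_system scale br H"
  shows "extended_affine_root_supersystem_conditions (group_closure R) (dual_form H B) R \<and>
         (R \<noteq> {0} \<longrightarrow> extended_affine_root_supersystem (group_closure R) (dual_form H B) R)"
proof -
  have conditions: "extended_affine_root_supersystem_conditions (group_closure R) (dual_form H B) R"
    using extended_affine_lie_superalgebra.root_supersystem[OF assms(1)] assms(2) by simp
  have "0 \<in> R" by (rule extended_affine_root_supersystem_conditions.S1(1)[OF conditions])
  then have "group_closure R \<noteq> {0}" if "R \<noteq> {0}"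
    using that group_closure.base[of _ R] by blast
  then show ?thesis
    using conditions
    by (simp add: extended_affine_root_supersystem_def extended_affine_root_supersystem_axioms_def)
qed

end
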